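(* Let $q$ be a prime power, let $n\geq 1$ be an integer, and let $f\in\mathbb{F}_q[x]$ be a monic polynomial with $f(0)\neq 0$. The number of monic irreducible polynomials in $\mathbb{F}_q[x]$ of degree $n$ whose $\mathbb{F}_q$-Order is $f$ equals $\dfrac{\phi(f)}{n}$ if $\mathrm{ord}(f)=n$, and equals $0$ otherwise.
   Context: For $h(x)=\sum_i a_i x^i\in\mathbb{F}_q[x]$, write $h\circ x=\sum_i a_i x^{q^i}\in\mathbb{F}_q[x]$. For $g\in\mathbb{F}_q[x]$ of degree at least $1$, the $\mathbb{F}_q$-Order of $g$ is the monic polynomial $h\in\mathbb{F}_q[x]$ of least degree such that $g\mid h\circ x$ in $\mathbb{F}_q[x]$. For $f\in\mathbb{F}_q[x]$ with $f(0)\neq0$, $\mathrm{ord}(f)$ is the least positive integer $e$ such that $f\mid x^e-1$. $\phi(f)$ denotes the polynomial Euler function: the number of units of the ring $\mathbb{F}_q[x]/(f)$ (with $\phi(1)=1$). *)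

theory Defs
  imports "HOL-Algebra.Algebraic_Closure_Type" "HOL-Computational_Algebra.Computational_Algebra" "HOL-Library.Cardinality"
begin

text \<open>
  The field \<open>\<bbbF>\<^sub>q\<close> is a type \<open>'a\<close> of class \<open>finite_field\<close>, with \<open>q = CARD('a)\<close>.
  \<open>q_linearized h\<close> is \<open>h \<circ> x\<close>, i.e.\ \<open>\<Sum>\<^sub>i a\<^sub>i x\<^bsup>q\<^sup>i\<^esup>\<close>
  for \<open>h = \<Sum>\<^sub>i a\<^sub>i x\<^sup>i\<close>; this is not the composition \<^const>\<open>pcompose\<close>.
\<close>

definition q_linearized :: "'a :: finite_field poly \<Rightarrow> 'a poly" where
  "q_linearized h = (\<Sum>i\<le>Polynomial.degree h. Polynomial.monom (Polynomial.coeff h i) (CARD('a) ^ i))"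

definition is_Fq_Order :: "'a :: finite_field poly \<Rightarrow> 'a poly \<Rightarrow> bool" where
  "is_Fq_Order g h \<longleftrightarrow>
     lead_coeff h = 1 \<and> g dvd q_linearized h \<and>
     (\<forall>h'. lead_coeff h' = 1 \<longrightarrow> g dvd q_linearized h' \<longrightarrow> Polynomial.degree h \<le> Polynomial.degree h')"

definition Fq_Order :: "'a :: finite_field poly \<Rightarrow> 'a poly" where
  "Fq_Order g = (THE h. is_Fq_Order g h)"

text \<open>Only meaningful if \<^term>\<open>poly f 0 \<noteq> 0\<close>.\<close>

definition poly_ord :: "'a :: finite_field poly \<Rightarrow> nat" where
  "poly_ord f = (LEAST e. e > 0 \<and> f dvd Polynomial.monom 1 e - 1)"

text \<open>
  For \<^term>\<open>f = 1\<close> the quotient is the zero ring, in which \<open>0 = 1\<close> is a unit, so the value is 1.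
\<close>

definition poly_phi :: "'a :: finite_field poly \<Rightarrow> nat" where
  "poly_phi f =
     (let R = (ring_of_type_algebra :: 'a poly ring)
      in card (Units (R Quot (PIdl\<^bsub>R\<^esub> f))))"


text \<open>The order of a nonzero polynomial exists and is unique.\<close>

lemma q_linearized_altdef:
  fixes h :: "'a :: finite_field poly"
  assumes "Polynomial.degree h \<le> N"
  shows "q_linearized h = (\<Sum>i\<le>N. Polynomial.monom (Polynomial.coeff h i) (CARD('a) ^ i))"
  unfolding q_linearized_def
  by (rule sum.mono_neutral_left) (use assms in \<open>auto simp: coeff_eq_0\<close>)

lemma q_linearized_diff:
  fixes h1 h2 :: "'a :: finite_field poly"
  shows "q_linearized (h1 - h2) = q_linearized h1 - q_linearized h2"
proof -
  define N where "N = max (Polynomial.degree h1) (Polynomial.degree h2)"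
  have "Polynomial.degree (h1 - h2) \<le> N"
    unfolding N_def by (rule degree_diff_le_max)
  then show ?thesis
    by (simp add: q_linearized_altdef[of _ N] N_def diff_monom [symmetric] sum_subtractf)
qed

lemma q_linearized_smult:
  fixes h :: "'a :: finite_field poly"
  shows "q_linearized (Polynomial.smult c h) = Polynomial.smult c (q_linearized h)"
proof -
  have "Polynomial.smult c (\<Sum>i\<in>A. F i) = (\<Sum>i\<in>A. Polynomial.smult c (F i))"
    for A and F :: "nat \<Rightarrow> 'a poly"
    by (induction A rule: infinite_finite_induct) (simp_all add: smult_add_right)
  then have "Polynomial.smult c (q_linearized h) =
      (\<Sum>i\<le>Polynomial.degree h. Polynomial.monom (c * Polynomial.coeff h i) (CARD('a) ^ i))"
    by (simp only: q_linearized_def smult_monom)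
  moreover have "q_linearized (Polynomial.smult c h) =
      (\<Sum>i\<le>Polynomial.degree h. Polynomial.monom (c * Polynomial.coeff h i) (CARD('a) ^ i))"
    by (subst q_linearized_altdef[OF degree_smult_le]) (simp only: coeff_smult)
  ultimately show ?thesis by simp
qed

lemma q_linearized_monom:
  "q_linearized (Polynomial.monom (1 :: 'a :: finite_field) n) = Polynomial.monom 1 (CARD('a) ^ n)"
proof -
  have "q_linearized (Polynomial.monom (1 :: 'a) n) =
          (\<Sum>i\<le>n. Polynomial.monom (if n = i then 1 else 0) (CARD('a) ^ i))"
    by (simp add: q_linearized_altdef[of _ n] degree_monom_le)
  also have "\<dots> = (\<Sum>i\<le>n. if n = i then Polynomial.monom 1 (CARD('a) ^ i) else 0)"
    by (intro sum.cong) auto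
  finally show ?thesis by simp
qed

lemma finite_polys_degree_le: "finite {p :: 'a :: finite_field poly. Polynomial.degree p \<le> d}"
proof (rule finite_subset)
  show "{p :: 'a poly. Polynomial.degree p \<le> d} \<subseteq> Poly ` {xs. set xs \<subseteq> UNIV \<and> length xs \<le> Suc d}"
  proof
    fix p :: "'a poly"
    assume "p \<in> {p. Polynomial.degree p \<le> d}"
    then have "length (Polynomial.coeffs p) \<le> Suc d"
      by (cases "p = 0") (auto simp: length_coeffs_degree)
    moreover have "p = Poly (Polynomial.coeffs p)"
      by simp
    ultimately show "p \<in> Poly ` {xs. set xs \<subseteq> UNIV \<and> length xs \<le> Suc d}"
      by blast
  qed
  show "finite (Poly ` {xs :: 'a list. set xs \<subseteq> UNIV \<and> length xs \<le> Suc d})"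
    by (intro finite_imageI finite_lists_length_le) simp
qed

lemma monic_q_linearized_multiple:
  fixes g h :: "'a :: finite_field poly"
  assumes "h \<noteq> 0" "g dvd q_linearized h"
  shows "\<exists>h'. lead_coeff h' = 1 \<and> g dvd q_linearized h' \<and> Polynomial.degree h' = Polynomial.degree h"
proof (intro exI conjI)
  let ?c = "inverse (lead_coeff h)"
  have c: "?c \<noteq> 0" using assms(1) by simp
  show "lead_coeff (Polynomial.smult ?c h) = 1"
    using assms(1) by (simp only: lead_coeff_smult) simp
  show "g dvd q_linearized (Polynomial.smult ?c h)"
    unfolding q_linearized_smult by (rule dvd_smult[OF assms(2)])
  show "Polynomial.degree (Polynomial.smult ?c h) = Polynomial.degree h"
    using c by (simp only: degree_smult_eq if_False)
qed

lemma ex_q_linearized_multiple: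
  fixes g :: "'a :: finite_field poly"
  assumes "g \<noteq> 0"
  shows "\<exists>h. h \<noteq> 0 \<and> g dvd q_linearized h"
proof -
  define F where "F i = Polynomial.monom (1 :: 'a) (CARD('a) ^ i) mod g" for i :: nat
  have "range F \<subseteq> {p. Polynomial.degree p \<le> Polynomial.degree g}"
  proof
    fix p assume "p \<in> range F"
    then obtain i where p: "p = F i" by auto
    have "F i = 0 \<or> Polynomial.degree (F i) < Polynomial.degree g"
      unfolding F_def by (rule degree_mod_less[OF assms])
    then show "p \<in> {p. Polynomial.degree p \<le> Polynomial.degree g}"
      using p by auto
  qed
  then have "finite (range F)"
    using finite_polys_degree_le finite_subset by blast
  then have "\<not> inj F"
    using finite_imageD infinite_UNIV_nat by blast
  then obtain i j where ij: "i \<noteq> j" "F i = F j"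
    by (auto simp: inj_def)
  have "g dvd q_linearized (Polynomial.monom 1 i - Polynomial.monom 1 j)"
    using ij(2) unfolding F_def q_linearized_diff q_linearized_monom
    by (simp add: mod_eq_dvd_iff)
  moreover have "Polynomial.monom (1 :: 'a) i - Polynomial.monom 1 j \<noteq> 0"
    using ij(1) by (auto simp: monom_eq_iff')
  ultimately show ?thesis by blast
qed

lemma ex1_Fq_Order:
  fixes g :: "'a :: finite_field poly"
  assumes "g \<noteq> 0"
  shows "\<exists>!h. is_Fq_Order g h"
proof (rule ex_ex1I)
  define P where "P h \<longleftrightarrow> lead_coeff h = 1 \<and> g dvd q_linearized h" for h
  obtain h0 where "P h0"
    using ex_q_linearized_multiple[OF assms] monic_q_linearized_multiple unfolding P_def by blast
  then have "\<exists>h. P h \<and> (\<forall>h'. P h' \<longrightarrow> Polynomial.degree h \<le> Polynomial.degree h')"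
    by (rule ex_has_least_nat)
  then show "\<exists>h. is_Fq_Order g h"
    unfolding P_def is_Fq_Order_def by blast
next
  fix h1 h2
  assume *: "is_Fq_Order g h1" "is_Fq_Order g h2"
  have deg: "Polynomial.degree h1 = Polynomial.degree h2"
    using * unfolding is_Fq_Order_def by (meson order_antisym)
  show "h1 = h2"
  proof (rule ccontr)
    assume "h1 \<noteq> h2"
    then have nz: "h1 - h2 \<noteq> 0" by simp
    have "g dvd q_linearized (h1 - h2)"
      using * unfolding is_Fq_Order_def q_linearized_diff by auto
    then obtain h' where h': "lead_coeff h' = 1" "g dvd q_linearized h'"
        "Polynomial.degree h' = Polynomial.degree (h1 - h2)"
      using monic_q_linearized_multiple[OF nz] by blast
    then have le: "Polynomial.degree h1 \<le> Polynomial.degree (h1 - h2)"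
      using * unfolding is_Fq_Order_def by metis
    have "Polynomial.degree (h1 - h2) \<le> Polynomial.degree h1"
      using deg degree_diff_le_max[of h1 h2] by simp
    with le have "Polynomial.degree (h1 - h2) = Polynomial.degree h1" by simp
    then have "lead_coeff (h1 - h2) = lead_coeff h1 - lead_coeff h2"
      by (simp only: deg coeff_diff)
    also have "\<dots> = 0" using * by (simp add: is_Fq_Order_def)
    finally show False using nz by (simp only: leading_coeff_0_iff)
  qed
qed

lemma is_Fq_Order_Fq_Order: "g \<noteq> 0 \<Longrightarrow> is_Fq_Order g (Fq_Order g)"
  unfolding Fq_Order_def by (rule theI') (rule ex1_Fq_Order)

end

theory Submission
  imports Defs
begin

text \<open>
  Let \<open>K\<close> be the algebraic closure of \<open>\<bbbF>\<^sub>q\<close>, regarded as an \<open>\<bbbF>\<^sub>q[x]\<close>-module with \<open>x\<close> acting as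
  \<open>\<alpha> \<mapsto> \<alpha>\<^sup>q\<close>. An irreducible \<open>g\<close> with root \<open>\<alpha>\<close> has \<open>\<bbbF>\<^sub>q\<close>-Order \<open>f\<close> iff the annihilator of \<open>\<alpha>\<close> is \<open>(f)\<close>.
  As \<open>f dvd x\<^sup>e - 1\<close> iff \<open>\<alpha>\<close> is fixed by the \<open>e\<close>-th power of the Frobenius, \<open>ord f\<close> is then the degree of \<open>g\<close>.
  If \<open>f(0) \<noteq> 0\<close>, then \<open>f \<circ> x\<close> is separable, so \<open>f\<close> kills exactly \<open>q\<^bsup>deg f\<^esup>\<close> elements of \<open>K\<close>.
  Hence the numbers \<open>N(d)\<close> of elements with annihilator \<open>(d)\<close> satisfy \<open>\<Sum>\<^bsub>d dvd f\<^esub> N(d) = q\<^bsup>deg f\<^esup>\<close>,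
  as \<open>\<phi>\<close> does, which gives \<open>N = \<phi>\<close>; and each \<open>g\<close> counted has \<open>n\<close> distinct roots.
\<close>

subsection \<open>Polynomials over a field and the Euler function\<close>

text \<open>Division with remainder by a nonzero member of least degree, which is then made monic.
  Bezout relations and the annihilators of residues and of points all come from this.\<close>

lemma ideal_monic_generator:
  fixes I :: "'a :: field poly set"
  assumes add: "\<And>p q. p \<in> I \<Longrightarrow> q \<in> I \<Longrightarrow> p + q \<in> I"
    and mult: "\<And>p q. p \<in> I \<Longrightarrow> q * p \<in> I"
    and nontrivial: "h \<in> I" "h \<noteq> 0"
  obtains f where "lead_coeff f = 1" "\<And>h. h \<in> I \<longleftrightarrow> f dvd h"
proof -
  obtain g where g: "g \<in> I" "g \<noteq> 0"
      "\<And>p. p \<in> I \<Longrightarrow> p \<noteq> 0 \<Longrightarrow> Polynomial.degree g \<le> Polynomial.degree p"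
    using ex_has_least_nat[of "\<lambda>p. p \<in> I \<and> p \<noteq> 0" h Polynomial.degree] nontrivial by blast
  have g_dvd: "g dvd p" if "p \<in> I" for p
  proof -
    have "p mod g = p + (- (p div g)) * g"
      by (simp add: minus_div_mult_eq_mod [symmetric])
    then have "p mod g \<in> I"
      using add[OF that mult[OF g(1)]] by metis
    then have "p mod g = 0"
      using g(3)[of "p mod g"] degree_mod_less[OF g(2), of p] by linarith
    then show ?thesis by (simp add: dvd_eq_mod_eq_0)
  qed
  define f where "f = Polynomial.smult (inverse (lead_coeff g)) g"
  have f_dvd_iff: "f dvd p \<longleftrightarrow> g dvd p" for p
    using g(2) by (simp add: f_def smult_dvd_iff)
  show thesis
  proof (rule that)
    show "lead_coeff f = 1"
      unfolding f_def lead_coeff_smult using g(2) by simp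
    show "p \<in> I \<longleftrightarrow> f dvd p" for p
      unfolding f_dvd_iff using g_dvd mult[OF g(1)] by (metis dvdE mult.commute)
  qed
qed

lemma monic_dvd_antisym:
  fixes f g :: "'a :: field poly"
  assumes "lead_coeff f = 1" "lead_coeff g = 1" "f dvd g" "g dvd f"
  shows "f = g"
proof -
  obtain c where c: "g = f * c" using assms(3) by auto
  have nz: "f \<noteq> 0" "g \<noteq> 0" using assms(1,2) by auto
  then have "Polynomial.degree f = Polynomial.degree g"
    using assms(3,4) by (metis dvd_imp_degree_le order_antisym)
  with c nz have "Polynomial.degree c = 0"
    by (metis add_cancel_right_right degree_mult_eq mult_eq_0_iff)
  then obtain a where a: "c = [:a:]" by (rule degree_eq_zeroE)
  have "lead_coeff g = lead_coeff f * lead_coeff c"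
    unfolding c by (rule lead_coeff_mult)
  then have "a = 1" using assms(1,2) a by simp
  then show ?thesis using c a by simp
qed

text \<open>The ideal of all combinations of \<open>p\<close> and \<open>q\<close> is generated by a
  common divisor of the two, hence by a unit.\<close>

lemma coprime_poly_bezout:
  fixes p q :: "'a :: field poly"
  assumes "coprime p q"
  obtains a b where "a * p + b * q = 1"
proof (cases "p = 0 \<and> q = 0")
  case True
  then show ?thesis using assms by simp
next
  case False
  define I where "I = {a * p + b * q | a b. True}"
  have p: "p \<in> I" unfolding I_def by (rule CollectI, rule exI[of _ 1], rule exI[of _ 0]) simp
  have q: "q \<in> I" unfolding I_def by (rule CollectI, rule exI[of _ 0], rule exI[of _ 1]) simp
  have add: "u + v \<in> I" if "u \<in> I" "v \<in> I" for u v
  proof -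
    from that obtain a b c d where "u = a * p + b * q" "v = c * p + d * q"
      unfolding I_def by blast
    then have "u + v = (a + c) * p + (b + d) * q" by (simp add: algebra_simps)
    then show ?thesis unfolding I_def by blast
  qed
  have mult: "w * u \<in> I" if "u \<in> I" for u w
  proof -
    from that obtain a b where "u = a * p + b * q"
      unfolding I_def by blast
    then have "w * u = (w * a) * p + (w * b) * q" by (simp add: algebra_simps)
    then show ?thesis unfolding I_def by blast
  qed
  obtain h where "h \<in> I" "h \<noteq> 0" using False p q by blast
  then obtain d where d: "\<And>h. h \<in> I \<longleftrightarrow> d dvd h"
    using ideal_monic_generator[of I, OF add mult] by metis
  have "is_unit d"
    using assms p q d by (meson coprime_common_divisor)
  then have "1 \<in> I" using d by blast
  then show ?thesis using that unfolding I_def by auto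
qed

lemma coprime_dvd_mult_poly:
  fixes p q r :: "'a :: field poly"
  assumes "coprime p q" "q dvd r * p"
  shows "q dvd r"
proof -
  obtain a b where ab: "a * p + b * q = 1" using coprime_poly_bezout[OF assms(1)] .
  have "r = r * (a * p + b * q)" by (simp add: ab)
  also have "\<dots> = a * (r * p) + r * b * q" by (simp add: algebra_simps)
  also have "q dvd \<dots>" using assms(2) by simp
  finally show ?thesis .
qed

section \<open>Residues modulo a polynomial\<close>

lemma finite_monic_divisors:
  fixes f :: "'a :: finite_field poly"
  assumes "f \<noteq> 0"
  shows "finite {d. lead_coeff d = 1 \<and> d dvd f}"
  by (rule finite_subset[OF _ finite_polys_degree_le[of "Polynomial.degree f"]])
     (use assms dvd_imp_degree_le in blast)

text \<open>Splitting off the constant coefficient gives a factor \<open>q\<close> in each step.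
  Bounding through vanishing coefficients makes \<open>n = 0\<close> describe \<open>{0}\<close>,
  although the zero polynomial has degree 0.\<close>

lemma card_polys_degree_less:
  "finite {p :: 'a :: finite_field poly. \<forall>i\<ge>n. Polynomial.coeff p i = 0} \<and>
   card {p :: 'a poly. \<forall>i\<ge>n. Polynomial.coeff p i = 0} = CARD('a) ^ n"
proof (induction n)
  case 0
  have "{p :: 'a poly. \<forall>i\<ge>0. Polynomial.coeff p i = 0} = {0}"
    by (auto simp: poly_eq_iff)
  then show ?case by simp
next
  case (Suc n)
  let ?P = "\<lambda>n. {p :: 'a poly. \<forall>i\<ge>n. Polynomial.coeff p i = 0}"
  have "?P (Suc n) = (\<lambda>(a, p). pCons a p) ` (UNIV \<times> ?P n)"
  proof (intro equalityI subsetI)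
    fix p assume p: "p \<in> ?P (Suc n)"
    obtain a p' where p': "p = pCons a p'" by (cases p)
    have "Polynomial.coeff p' i = 0" if "i \<ge> n" for i
      using p that unfolding p' by (auto dest: spec[of _ "Suc i"])
    then show "p \<in> (\<lambda>(a, p). pCons a p) ` (UNIV \<times> ?P n)"
      using p' by auto
  next
    fix p assume "p \<in> (\<lambda>(a, p). pCons a p) ` (UNIV \<times> ?P n)"
    then show "p \<in> ?P (Suc n)"
      by (auto simp: coeff_pCons split: nat.splits)
  qed
  moreover have "inj_on (\<lambda>(a, p). pCons a p) (UNIV \<times> ?P n)"
    by (auto simp: inj_on_def)
  ultimately show ?case
    using Suc.IH by (simp add: card_image card_cartesian_product)
qed

lemma mod_poly_eq_self_iff:
  fixes f r :: "'a :: field poly"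
  assumes "f \<noteq> 0"
  shows "r mod f = r \<longleftrightarrow> (\<forall>i\<ge>Polynomial.degree f. Polynomial.coeff r i = 0)"
proof
  assume "r mod f = r"
  then have "r = 0 \<or> Polynomial.degree r < Polynomial.degree f"
    using degree_mod_less[OF assms, of r] by simp
  then show "\<forall>i\<ge>Polynomial.degree f. Polynomial.coeff r i = 0"
    by (auto simp: coeff_eq_0)
next
  assume "\<forall>i\<ge>Polynomial.degree f. Polynomial.coeff r i = 0"
  then have "r = 0 \<or> Polynomial.degree r < Polynomial.degree f"
    by (metis leading_coeff_0_iff not_le)
  then show "r mod f = r"
    by (auto simp: mod_poly_less)
qed

lemma card_residues:
  fixes f :: "'a :: finite_field poly"
  assumes "f \<noteq> 0"
  shows "finite {r. r mod f = r}" "card {r. r mod f = r} = CARD('a) ^ Polynomial.degree f"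
  unfolding mod_poly_eq_self_iff[OF assms] using card_polys_degree_less by blast+

text \<open>Canonical representatives of the unit classes modulo \<open>f\<close>. For
  \<open>f = 1\<close> the residue 0 counts, being coprime to 1, so the count is 1.\<close>

definition unit_residues :: "'a :: field poly \<Rightarrow> 'a poly set" where
  "unit_residues f = {r. r mod f = r \<and> coprime r f}"

text \<open>
  The residue \<open>r\<close> modulo \<open>f\<close> with annihilator generated by \<open>d\<close> is \<open>(f / d) s\<close> for a unit
  residue \<open>s\<close> modulo \<open>d\<close>.
\<close>

lemma sum_card_unit_residues:
  fixes f :: "'a :: finite_field poly"
  assumes "f \<noteq> 0"
  shows "(\<Sum>d | lead_coeff d = 1 \<and> d dvd f. card (unit_residues d)) = CARD('a) ^ Polynomial.degree f"
proof -
  let ?D = "{d. lead_coeff d = 1 \<and> d dvd f}"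
  let ?F = "\<lambda>(d, s). f div d * s"
  have D: "f div d \<noteq> 0" "d * (f div d) = f" "d \<noteq> 0" if "d \<in> ?D" for d
  proof -
    show *: "d * (f div d) = f" using that by simp
    show "f div d \<noteq> 0" "d \<noteq> 0" using * assms by fastforce+
  qed
  \<comment> \<open>In \<open>f = (f div d) * d\<close> the factor \<open>f div d\<close> cancels,
    and \<open>s\<close> is invertible modulo \<open>d\<close>: the annihilator of
    \<open>f div d * s\<close> modulo \<open>f\<close> is generated by \<open>d\<close>.\<close>
  have ann: "f dvd h * (f div d * s) \<longleftrightarrow> d dvd h" if "d \<in> ?D" "coprime s d" for d s h
  proof -
    have "f div d * d = f" using D(2)[OF that(1)] by (simp only: mult.commute)
    then have "f dvd h * (f div d * s) \<longleftrightarrow> f div d * d dvd f div d * (h * s)"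
      by (metis mult.left_commute)
    with dvd_times_left_cancel_iff[OF D(1)[OF that(1)]]
    have *: "f dvd h * (f div d * s) \<longleftrightarrow> d dvd h * s" by blast
    have "d dvd h * s \<longleftrightarrow> d dvd h"
      using coprime_dvd_mult_poly[OF that(2)] dvd_mult2 by blast
    with * show ?thesis by blast
  qed
  have residue: "f div d * s mod f = f div d * s \<longleftrightarrow> s mod d = s" if "d \<in> ?D" for d s
  proof -
    have "f div d * s mod f = f div d * s mod (f div d * d)"
      using D(2)[OF that] by (simp only: mult.commute)
    also have "\<dots> = f div d * (s mod d)"
      by (rule mod_mult_mult1)
    finally show ?thesis using mult_left_cancel[OF D(1)[OF that]] by simp
  qed
  have inj: "inj_on ?F (SIGMA d:?D. unit_residues d)"
  proof (rule inj_onI, clarify)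
    fix d s d' s'
    assume *: "lead_coeff d = 1" "d dvd f" "s \<in> unit_residues d"
      "lead_coeff d' = 1" "d' dvd f" "s' \<in> unit_residues d'" "f div d * s = f div d' * s'"
    have cop: "coprime s d" "coprime s' d'"
      using *(3,6) unfolding unit_residues_def by blast+
    have dD: "d \<in> ?D" "d' \<in> ?D" using *(1,2,4,5) by blast+
    \<comment> \<open>Equal residues have equal annihilators, which recovers \<open>d\<close>; then
      \<open>s\<close> follows by cancellation.\<close>
    have dvd_iff: "d dvd h \<longleftrightarrow> d' dvd h" for h
      using trans[OF ann[OF dD(1) cop(1), of h, unfolded *(7), symmetric] ann[OF dD(2) cop(2), of h]] .
    have "d = d'"
      by (rule monic_dvd_antisym[OF *(1,4)]) (simp_all add: dvd_iff flip: dvd_iff[of d])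
    moreover from this have "s = s'" using mult_left_cancel[OF D(1)[OF dD(1)]] *(7) by blast
    ultimately show "d = d' \<and> s = s'" ..
  qed
  have image: "?F ` (SIGMA d:?D. unit_residues d) = {r. r mod f = r}"
  proof (intro equalityI subsetI)
    fix r assume "r \<in> ?F ` (SIGMA d:?D. unit_residues d)"
    then obtain ds where "ds \<in> (SIGMA d:?D. unit_residues d)" and r: "r = ?F ds"
      by blast
    then obtain d s where "d \<in> ?D" "s \<in> unit_residues d" and ds: "ds = (d, s)"
      by blast
    moreover have "r = f div d * s" using r unfolding ds by (simp only: prod.case)
    ultimately show "r \<in> {r. r mod f = r}"
      using residue[of d s] unfolding unit_residues_def by blast
  next
    fix r assume r: "r \<in> {r. r mod f = r}"
    \<comment> \<open>\<open>d\<close> generates the annihilator of \<open>r\<close> modulo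
      \<open>f\<close>; since \<open>f\<close> lies in it, \<open>d dvd f\<close>.\<close>
    obtain d where d: "lead_coeff d = 1" "\<And>h. h \<in> {h. f dvd h * r} \<longleftrightarrow> d dvd h"
    proof (rule ideal_monic_generator[of "{h. f dvd h * r}" f])
      show "p + q \<in> {h. f dvd h * r}" if "p \<in> {h. f dvd h * r}" "q \<in> {h. f dvd h * r}" for p q
        using that by (simp add: distrib_right)
      show "q * p \<in> {h. f dvd h * r}" if "p \<in> {h. f dvd h * r}" for p q
        using that by (simp add: mult.assoc)
    qed (use assms in auto)
    have d_dvd: "d dvd h \<longleftrightarrow> f dvd h * r" for h using d(2) by blast
    have dD: "d \<in> ?D" using d(1) d_dvd[of f] by simp
    \<comment> \<open>\<open>d\<close> itself kills \<open>r\<close>; cancelling \<open>d\<close>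
      exhibits \<open>r\<close> as a multiple of \<open>f div d\<close>.\<close>
    have "d * (f div d) dvd d * r"
      unfolding D(2)[OF dD] using d_dvd[of d] dvd_refl by blast
    then have "f div d dvd r"
      using dvd_times_left_cancel_iff[OF D(3)[OF dD]] by blast
    then obtain s where s: "r = f div d * s" by auto
    have "coprime s d"
    proof (rule coprimeI)
      fix c assume c: "c dvd s" "c dvd d"
      then obtain s' d' where s': "s = c * s'" and d': "d = c * d'" by (elim dvdE)
      \<comment> \<open>With a common factor \<open>c\<close>, already \<open>d' = d / c\<close>
        kills \<open>r\<close>, so \<open>d\<close> divides \<open>d'\<close> and \<open>c\<close>
        is a unit.\<close>
      have "f dvd d' * r"
      proof -
        have "d' * r = (c * d') * (f div d) * s'"
          unfolding s s' by (simp only: mult_ac)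
        also have "\<dots> = f * s'"
          unfolding d' [symmetric] D(2)[OF dD] ..
        finally show ?thesis by (rule dvdI)
      qed
      then have "c * d' dvd 1 * d'"
        unfolding d' [symmetric] mult_1 using d_dvd by blast
      moreover have "d' \<noteq> 0" using d' D(3)[OF dD] by auto
      ultimately show "is_unit c" using dvd_mult_cancel_right by blast
    qed
    moreover have "s mod d = s" using residue[OF dD] r unfolding s by blast
    ultimately have ds: "(d, s) \<in> (SIGMA d:?D. unit_residues d)"
      using dD unfolding unit_residues_def by blast
    have "r = ?F (d, s)" using s by (simp only: prod.case)
    then show "r \<in> ?F ` (SIGMA d:?D. unit_residues d)"
      using ds by (rule image_eqI)
  qed
  have "finite (unit_residues d)" if "d \<in> ?D" for d
    using card_residues(1)[OF D(3)[OF that]] by (rule finite_subset[rotated]) (unfold unit_residues_def, blast)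
  then have "(\<Sum>d\<in>?D. card (unit_residues d)) = card (SIGMA d:?D. unit_residues d)"
    using finite_monic_divisors[OF assms] by (subst card_SigmaI) auto
  also have "\<dots> = card {r. r mod f = r}"
    using card_image[OF inj] image by simp
  finally show ?thesis using card_residues(2)[OF assms] by simp
qed

text \<open>Induction on the degree in place of Moebius inversion: proper monic divisors of
  \<open>f\<close> have smaller degree and again a nonzero value at 0, so the sum determines the one
  remaining term \<open>N f\<close>.\<close>

lemma card_eq_card_unit_residues:
  fixes N :: "'a :: finite_field poly \<Rightarrow> nat"
  assumes sum: "\<And>f. lead_coeff f = 1 \<Longrightarrow> poly f 0 \<noteq> 0 \<Longrightarrow>
      (\<Sum>d | lead_coeff d = 1 \<and> d dvd f. N d) = CARD('a) ^ Polynomial.degree f"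
    and "lead_coeff f = 1" "poly f 0 \<noteq> 0"
  shows "N f = card (unit_residues f)"
  using assms(2,3)
proof (induction "Polynomial.degree f" arbitrary: f rule: less_induct)
  case less
  let ?D = "{d. lead_coeff d = 1 \<and> d dvd f}"
  have f: "f \<noteq> 0" "f \<in> ?D" using less.prems by auto
  have fin: "finite ?D" using finite_monic_divisors[OF f(1)] .
  have "N d = card (unit_residues d)" if d: "d \<in> ?D - {f}" for d
  proof (rule less.hyps)
    have le: "Polynomial.degree d \<le> Polynomial.degree f"
      using d f(1) dvd_imp_degree_le by blast
    have "Polynomial.degree d \<noteq> Polynomial.degree f"
    proof
      assume eq: "Polynomial.degree d = Polynomial.degree f"
      obtain c where c: "f = d * c" using d by auto
      then have "c \<noteq> 0" "d \<noteq> 0" using f(1) by auto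
      then have "Polynomial.degree c = 0" using eq c by (simp add: degree_mult_eq)
      then obtain a where "c = [:a:]" by (rule degree_eq_zeroE)
      with \<open>c \<noteq> 0\<close> have "is_unit c" by (simp add: is_unit_const_poly_iff dvd_field_iff)
      then have "f dvd d" using c by simp
      then show False using d monic_dvd_antisym[of d f] less.prems(1) by blast
    qed
    then show "Polynomial.degree d < Polynomial.degree f" using le by simp
    show "lead_coeff d = 1" "poly d 0 \<noteq> 0" using d less.prems(2) by auto
  qed
  then have "(\<Sum>d\<in>?D - {f}. N d) = (\<Sum>d\<in>?D - {f}. card (unit_residues d))"
    by (rule sum.cong[OF refl])
  moreover have "(\<Sum>d\<in>?D. N d) = (\<Sum>d\<in>?D. card (unit_residues d))"
    using sum[OF less.prems] sum_card_unit_residues[OF f(1)] by simp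
  ultimately show ?case
    using sum.remove[OF fin f(2), of N] sum.remove[OF fin f(2), of "\<lambda>d. card (unit_residues d)"]
    by linarith
qed

text \<open>Each class of the quotient contains exactly one residue, and by Bezout it is a unit
  precisely when that residue is coprime to \<open>f\<close>.\<close>

lemma poly_phi_eq_card_unit_residues:
  fixes f :: "'a :: finite_field poly"
  shows "poly_phi f = card (unit_residues f)"
proof -
  define R where "R = (ring_of_type_algebra :: 'a poly ring)"
  have R: "carrier R = UNIV" "\<And>x y. x \<otimes>\<^bsub>R\<^esub> y = x * y" "\<one>\<^bsub>R\<^esub> = 1" "\<And>x y. x \<oplus>\<^bsub>R\<^esub> y = x + y"
    by (simp_all add: R_def ring_of_type_algebra_def)
  define I where "I = PIdl\<^bsub>R\<^esub> f"
  interpret R: cring R unfolding R_def by rule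
  interpret I: ideal I R unfolding I_def by (rule R.cgenideal_ideal) (simp add: R)
  have I_iff: "x \<in> I \<longleftrightarrow> f dvd x" for x
    unfolding I_def cgenideal_def by (auto simp: R mult.commute dvd_def)
  define C where "C r = I +>\<^bsub>R\<^esub> r" for r
  have C_eq: "C r = {x. f dvd x - r}" for r
    unfolding C_def a_r_coset_def'
    by (auto simp: R I_iff)
  have C_eq_iff: "C r = C s \<longleftrightarrow> f dvd r - s" for r s
  proof
    assume "C r = C s"
    moreover have "r \<in> C r" by (simp add: C_eq)
    ultimately show "f dvd r - s" by (simp add: C_eq)
  next
    assume *: "f dvd r - s"
    have "f dvd x - r \<longleftrightarrow> f dvd x - s" for x
      using dvd_add[OF _ *, of "x - r"] dvd_diff[OF _ *, of "x - s"] by auto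
    then show "C r = C s" by (simp add: C_eq)
  qed
  have Q: "carrier (R Quot I) = range C" "\<one>\<^bsub>R Quot I\<^esub> = C 1"
    "C r \<otimes>\<^bsub>R Quot I\<^esub> C s = C (r * s)" for r s
    using I.rcoset_mult_add[of r s]
    by (auto simp: FactRing_def A_RCOSETS_def' C_def R)
  have unit_iff: "C r \<in> Units (R Quot I) \<longleftrightarrow> coprime r f" for r
  proof
    assume "C r \<in> Units (R Quot I)"
    then obtain s where "C (s * r) = C 1"
      unfolding Units_def Q by (auto simp: Q)
    then have "f dvd s * r - 1" by (simp add: C_eq_iff)
    then obtain t where t: "s * r - 1 = f * t" by auto
    then have "s * r - f * t = 1" by (simp add: algebra_simps)
    then show "coprime r f"
      by (metis coprimeI dvd_diff dvd_mult dvd_mult2)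
  next
    assume "coprime r f"
    then obtain a b where "a * r + b * f = 1" by (rule coprime_poly_bezout)
    then have "a * r - 1 = - (b * f)" by (simp add: algebra_simps eq_neg_iff_add_eq_0)
    then have "f dvd a * r - 1" by simp
    then have "C (a * r) = C 1" "C (r * a) = C 1"
      by (simp_all add: C_eq_iff mult.commute)
    then show "C r \<in> Units (R Quot I)"
      unfolding Units_def Q by (auto simp: Q)
  qed
  have "bij_betw C (unit_residues f) (Units (R Quot I))"
  proof (rule bij_betwI')
    fix r s assume "r \<in> unit_residues f" "s \<in> unit_residues f"
    then show "C r = C s \<longleftrightarrow> r = s"
      by (auto simp: C_eq_iff unit_residues_def simp flip: mod_eq_dvd_iff)
  next
    fix r assume "r \<in> unit_residues f"
    then show "C r \<in> Units (R Quot I)" by (simp add: unit_iff unit_residues_def)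
  next
    fix U assume U: "U \<in> Units (R Quot I)"
    then obtain r where r: "U = C r" unfolding Units_def Q by auto
    have *: "U = C (r mod f)"
      unfolding r C_eq_iff by (simp flip: mod_eq_dvd_iff)
    then have "r mod f \<in> unit_residues f"
      using U unit_iff by (simp add: unit_residues_def)
    then show "\<exists>r\<in>unit_residues f. U = C r" using * by blast
  qed
  then show ?thesis
    unfolding poly_phi_def Let_def by (simp add: bij_betw_same_card flip: R_def I_def)
qed

subsection \<open>The Frobenius endomorphism of the closure\<close>

lemma one_less_card_field: "1 < CARD('a :: finite_field)"
  using card_mono[of UNIV "{0, 1 :: 'a}"] by simp

text \<open>Both sides are monic of degree \<open>q\<close> and vanish on the ground field, so their
  difference has degree below \<open>q\<close> but \<open>q\<close> zeros.\<close>

lemma monom_minus_X_eq_prod: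
  "Polynomial.monom 1 CARD('a) - [:0, 1:] = (\<Prod>c\<in>(UNIV :: 'a :: finite_field set). [:- to_ac c, 1:])"
proof (rule poly_eqI_degree_lead_coeff[where A = "range to_ac" and n = "CARD('a)"])
  have q: "CARD('a) > 1"
    by (rule one_less_card_field)
  have deg: "Polynomial.degree (\<Prod>c\<in>(UNIV :: 'a set). [:- to_ac c, 1:]) = CARD('a)"
    by (subst degree_prod_sum_eq) auto
  have lead: "lead_coeff (\<Prod>c\<in>(UNIV :: 'a set). [:- to_ac c, 1:]) = 1"
    by (simp add: lead_coeff_prod)
  show "Polynomial.coeff (Polynomial.monom 1 CARD('a) - [:0, 1:]) CARD('a) =
      Polynomial.coeff (\<Prod>c\<in>(UNIV :: 'a set). [:- to_ac c, 1:]) CARD('a)"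
    using lead q unfolding deg by (auto simp: coeff_pCons split: nat.splits)
  show "CARD('a) \<le> card (range (to_ac :: 'a \<Rightarrow> _))"
    by (simp add: card_image inj_to_ac)
  show "Polynomial.degree (Polynomial.monom (1 :: 'a alg_closure) CARD('a) - [:0, 1:]) \<le> CARD('a)"
    using q by (intro degree_diff_le) (auto simp: degree_monom_le)
  show "Polynomial.degree (\<Prod>c\<in>(UNIV :: 'a set). [:- to_ac c, 1:]) \<le> CARD('a)"
    using deg by simp
  show "poly (Polynomial.monom 1 CARD('a) - [:0, 1:]) z = poly (\<Prod>c\<in>UNIV. [:- to_ac c, 1:]) z"
    if "z \<in> range (to_ac :: 'a \<Rightarrow> _)" for z
  proof -
    from that obtain a :: 'a where z: "z = to_ac a" by blast
    have "z ^ CARD('a) = z"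
      unfolding z to_ac_power [symmetric] finite_field_power_card_eq_same ..
    moreover have "poly (\<Prod>c\<in>(UNIV :: 'a set). [:- to_ac c, 1:]) z = 0"
      unfolding poly_prod z by (rule prod_zero) auto
    ultimately show ?thesis by (simp add: poly_monom)
  qed
qed

lemma power_card_minus_self_eq_prod:
  fixes x :: "'a :: finite_field alg_closure"
  shows "x ^ CARD('a) - x = (\<Prod>c\<in>(UNIV :: 'a set). x - to_ac c)"
  using arg_cong[OF monom_minus_X_eq_prod, of "\<lambda>p. poly p x"]
  by (simp add: poly_monom poly_prod)

text \<open>
  For \<open>y\<close> in the closure, \<open>(x + y)\<^sup>q - (x + y)\<close> and \<open>x\<^sup>q - x + (y\<^sup>q - y)\<close> are monic of degree \<open>q\<close> in \<open>x\<close>,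
  and they agree at the \<open>q\<close> elements of the ground field.
\<close>

lemma power_card_add:
  fixes x y :: "'a :: finite_field alg_closure"
  shows "(x + y) ^ CARD('a) = x ^ CARD('a) + y ^ CARD('a)"
proof -
  let ?q = "CARD('a)"
  have q: "?q > 1"
    by (rule one_less_card_field)
  let ?P = "[:y, 1:] ^ ?q - [:y, 1:]"
  let ?Q = "Polynomial.monom 1 ?q - [:0, 1:] + [:y ^ ?q - y:]"
  \<comment> \<open>Translation by \<open>a\<close> permutes the ground field, so it only reorders
    the factors of the product.\<close>
  have shift: "(to_ac a + y) ^ ?q - (to_ac a + y) = y ^ ?q - y" for a :: 'a
    unfolding power_card_minus_self_eq_prod
    by (rule prod.reindex_bij_witness[of _ "\<lambda>c. c + a" "\<lambda>c. c - a"]) auto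
  have deg: "Polynomial.degree ([:y, 1:] ^ ?q) = ?q"
    by (simp add: degree_power_eq)
  have lead: "lead_coeff ([:y, 1:] ^ ?q) = 1"
    by (simp add: lead_coeff_power)
  have "?P = ?Q"
  proof (rule poly_eqI_degree_lead_coeff[where A = "range to_ac" and n = ?q])
    show "Polynomial.coeff ?P ?q = Polynomial.coeff ?Q ?q"
      using lead q unfolding deg by (auto simp: coeff_pCons split: nat.splits)
    show "?q \<le> card (range (to_ac :: 'a \<Rightarrow> _))"
      by (simp add: card_image inj_to_ac)
    show "Polynomial.degree ?P \<le> ?q"
      using q deg by (intro degree_diff_le) auto
    show "Polynomial.degree ?Q \<le> ?q"
      using q by (intro degree_diff_le degree_add_le) (auto simp: degree_monom_le)
    show "poly ?P z = poly ?Q z" if "z \<in> range (to_ac :: 'a \<Rightarrow> _)" for z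
    proof -
      from that obtain a :: 'a where z: "z = to_ac a" by blast
      have "z ^ ?q = z"
        unfolding z to_ac_power [symmetric] finite_field_power_card_eq_same ..
      then show ?thesis
        using shift[of a] z by (simp add: poly_monom poly_power add.commute)
    qed
  qed
  from arg_cong[OF this, of "\<lambda>p. poly p x"] show ?thesis
    by (simp add: poly_monom poly_power algebra_simps)
qed

lemma power_card_power_add:
  fixes x y :: "'a :: finite_field alg_closure"
  shows "(x + y) ^ (CARD('a) ^ k) = x ^ (CARD('a) ^ k) + y ^ (CARD('a) ^ k)"
  by (induction k) (simp_all only: power_0 power_one_right power_Suc2 power_mult power_card_add)

lemma to_ac_power_card_power: "to_ac (c :: 'a :: finite_field) ^ (CARD('a) ^ k) = to_ac c"
  by (simp add: finite_field_power_card_power_eq_same flip: to_ac_power)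

section \<open>Evaluating ground field polynomials in the closure\<close>

definition poly_ac :: "'a :: field poly \<Rightarrow> 'a alg_closure \<Rightarrow> 'a alg_closure" where
  "poly_ac p x = poly (map_poly to_ac p) x"

lemma map_poly_to_ac_mult: "map_poly to_ac (p * q) = map_poly to_ac p * map_poly to_ac q"
  by (rule poly_eqI) (simp add: coeff_map_poly coeff_mult to_ac_sum)

lemma poly_ac_0 [simp]: "poly_ac 0 x = 0"
  and poly_ac_1 [simp]: "poly_ac 1 x = 1"
  and poly_ac_pCons [simp]: "poly_ac (pCons c p) x = to_ac c + x * poly_ac p x"
  and poly_ac_monom: "poly_ac (Polynomial.monom c n) x = to_ac c * x ^ n"
  and poly_ac_mult: "poly_ac (p * q) x = poly_ac p x * poly_ac q x"
  by (simp_all add: poly_ac_def map_poly_pCons map_poly_monom poly_monom map_poly_to_ac_mult)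

lemma poly_ac_add: "poly_ac (p + q) x = poly_ac p x + poly_ac q x"
proof -
  have "map_poly to_ac (p + q) = map_poly to_ac p + map_poly to_ac q"
    by (rule poly_eqI) (simp add: coeff_map_poly)
  then show ?thesis by (simp add: poly_ac_def)
qed

lemma poly_ac_diff: "poly_ac (p - q) x = poly_ac p x - poly_ac q x"
  using poly_ac_add[of "p - q" q x] by simp

lemma poly_ac_sum: "poly_ac (\<Sum>i\<in>A. f i) x = (\<Sum>i\<in>A. poly_ac (f i) x)"
  by (induction A rule: infinite_finite_induct) (simp_all add: poly_ac_add)

text \<open>The Frobenius is a ring endomorphism fixing the coefficients of \<open>p\<close>. Hence
  a power of it that fixes \<open>x\<close> fixes all of \<open>F_q(x)\<close>.\<close>

lemma poly_ac_power_card_power: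
  fixes p :: "'a :: finite_field poly"
  shows "poly_ac p x ^ (CARD('a) ^ k) = poly_ac p (x ^ (CARD('a) ^ k))"
  by (induction p) (simp_all add: power_card_power_add to_ac_power_card_power power_mult_distrib)

text \<open>This \<open>g\<close> is the minimal polynomial of \<open>x\<close>. The ideal is
  nonzero as the closure is algebraic, and \<open>g\<close> is irreducible as the closure has no
  zero divisors.\<close>

lemma ex_irreducible_annihilator:
  fixes x :: "'a :: field alg_closure"
  shows "\<exists>g. lead_coeff g = 1 \<and> Factorial_Ring.irreducible g \<and> (\<forall>p. poly_ac p x = 0 \<longleftrightarrow> g dvd p)"
proof -
  obtain h :: "'a poly" where h: "h \<noteq> 0" "poly_ac h x = 0"
    unfolding poly_ac_def by (rule alg_closure_algebraic)
  obtain g where g: "lead_coeff g = 1" "\<And>p. p \<in> {p. poly_ac p x = 0} \<longleftrightarrow> g dvd p"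
    by (rule ideal_monic_generator[of "{p. poly_ac p x = 0}" h])
       (use h in \<open>auto simp: poly_ac_add poly_ac_mult\<close>)
  have dvd: "poly_ac p x = 0 \<longleftrightarrow> g dvd p" for p using g(2) by blast
  have "Factorial_Ring.irreducible g"
  proof (rule irreducibleI)
    show "g \<noteq> 0" using g(1) by auto
    show "\<not> is_unit g" using dvd[of 1] by simp
    fix a b assume ab: "g = a * b"
    have nz: "a \<noteq> 0" "b \<noteq> 0" using ab \<open>g \<noteq> 0\<close> by auto
    have "poly_ac a x = 0 \<or> poly_ac b x = 0"
      using dvd[of g] by (simp add: ab poly_ac_mult)
    \<comment> \<open>A factor vanishing at \<open>x\<close> is a multiple of
      \<open>g = a * b\<close>; cancelling it shows that the other factor is a unit.\<close>
    then have "a * b dvd a * 1 \<or> a * b dvd 1 * b"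
      by (simp only: dvd ab mult_1 mult_1_right)
    then show "is_unit a \<or> is_unit b"
      using nz dvd_times_left_cancel_iff dvd_times_right_cancel_iff by blast
  qed
  then show ?thesis using g(1) dvd by blast
qed

text \<open>Irreducibility makes \<open>g\<close> a unit multiple of the minimal polynomial of
  \<open>x\<close>.\<close>

lemma poly_ac_eq_0_iff_irreducible_dvd:
  fixes g :: "'a :: field poly"
  assumes "Factorial_Ring.irreducible g" "poly_ac g x = 0"
  shows "poly_ac p x = 0 \<longleftrightarrow> g dvd p"
proof -
  obtain m where m: "Factorial_Ring.irreducible m" and "\<forall>p. poly_ac p x = 0 \<longleftrightarrow> m dvd p"
    using ex_irreducible_annihilator[of x] by blast
  then have m_dvd: "poly_ac p x = 0 \<longleftrightarrow> m dvd p" for p by blast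
  have "m dvd g" using assms(2) m_dvd by blast
  then obtain c where c: "g = m * c" by (elim dvdE)
  then have "is_unit c"
    using irreducibleD[OF assms(1) c] m irreducible_not_unit by blast
  then show ?thesis
    unfolding m_dvd c by (simp add: mult_unit_dvd_iff)
qed

lemma ex_root_in_closure:
  fixes g :: "'a :: field poly"
  assumes "Factorial_Ring.irreducible g"
  obtains x where "poly_ac g x = 0"
proof -
  have "Polynomial.degree (map_poly to_ac g) > 0"
    using assms by (auto simp: degree_map_poly irreducible_def is_unit_iff_degree)
  then have "\<exists>x. poly (map_poly to_ac g) x = 0"
    by (intro alg_closed_imp_poly_has_root)
  then show thesis using that unfolding poly_ac_def by blast
qed

subsection \<open>The Frobenius module structure\<close>

text \<open>\<open>act h\<close> is the operator \<open>x \<mapsto> (h \<circ> x)(x)\<close> of the \<open>\<bbbF>\<^sub>q[x]\<close>-module given by the Frobenius on the closure.\<close>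

definition act :: "'a :: finite_field poly \<Rightarrow> 'a alg_closure \<Rightarrow> 'a alg_closure" where
  "act h x = poly_ac (q_linearized h) x"

lemma act_eq_sum:
  fixes h :: "'a :: finite_field poly"
  assumes "Polynomial.degree h \<le> N"
  shows "act h x = (\<Sum>i\<le>N. to_ac (Polynomial.coeff h i) * x ^ (CARD('a) ^ i))"
  unfolding act_def q_linearized_altdef[OF assms] by (simp add: poly_ac_sum poly_ac_monom)

lemma act_0 [simp]: "act 0 x = 0"
  by (simp add: act_def q_linearized_def)

text \<open>The recursion behind the inductions on \<open>h\<close>: multiplication by the
  indeterminate becomes the Frobenius.\<close>

lemma act_pCons [simp]:
  fixes h :: "'a :: finite_field poly"
  shows "act (pCons c h) x = to_ac c * x + act h (x ^ CARD('a))"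
proof -
  have "act (pCons c h) x = (\<Sum>i\<le>Suc (Polynomial.degree h). to_ac (Polynomial.coeff (pCons c h) i) * x ^ (CARD('a) ^ i))"
    by (rule act_eq_sum) (rule degree_pCons_le)
  also have "\<dots> = to_ac c * x + act h (x ^ CARD('a))"
    by (subst sum.atMost_Suc_shift) (simp add: act_eq_sum[OF order_refl] power_mult)
  finally show ?thesis .
qed

lemma act_diff: "act (p - q) x = act p x - act q x"
  by (simp add: act_def q_linearized_diff poly_ac_diff)

lemma act_add_poly: "act (p + q) x = act p x + act q x"
  using act_diff[of "p + q" q x] by simp

lemma act_smult: "act (Polynomial.smult c p) x = to_ac c * act p x"
proof -
  have "Polynomial.smult c r = [:c:] * r" for r :: "'a poly" by simp
  then show ?thesis
    unfolding act_def q_linearized_smult by (simp only: poly_ac_mult) simp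
qed

lemma act_monom:
  fixes x :: "'a :: finite_field alg_closure"
  shows "act (Polynomial.monom 1 e) x = x ^ (CARD('a) ^ e)"
  by (simp add: act_def q_linearized_monom poly_ac_monom)

text \<open>\<open>q_linearized h\<close> has its coefficients in the ground field, which the
  Frobenius fixes.\<close>

lemma act_power_card:
  fixes x :: "'a :: finite_field alg_closure"
  shows "act h (x ^ CARD('a)) = act h x ^ CARD('a)"
  using poly_ac_power_card_power[of "q_linearized h" x 1] by (simp add: act_def)

text \<open>The module law, by which the annihilator of a point is an ideal.\<close>

lemma act_mult: "act (p * q) x = act p (act q x)"
  by (induction p arbitrary: x) (simp_all add: act_add_poly act_smult act_power_card)

lemma act_1 [simp]: "act 1 x = x"
  by (simp add: one_pCons)

lemma act_zero_right [simp]: "act h 0 = 0"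
  by (induction h) (simp_all add: zero_power)

text \<open>As \<open>f\<close> runs over the monic polynomials, these sets partition the
  closure.\<close>

definition with_annihilator :: "'a :: finite_field poly \<Rightarrow> 'a alg_closure set" where
  "with_annihilator f = {x. \<forall>h. act h x = 0 \<longleftrightarrow> f dvd h}"

lemma with_annihilatorD: "x \<in> with_annihilator f \<Longrightarrow> act h x = 0 \<longleftrightarrow> f dvd h"
  by (simp add: with_annihilator_def)

text \<open>The minimal polynomial of \<open>x\<close> divides some \<open>q_linearized h\<close>
  with \<open>h \<noteq> 0\<close>, so the annihilator is a nonzero ideal.\<close>

lemma ex_annihilator:
  fixes x :: "'a :: finite_field alg_closure"
  obtains f where "lead_coeff f = 1" "x \<in> with_annihilator f"
proof -
  obtain g where "lead_coeff g = 1" and g: "\<forall>p. poly_ac p x = 0 \<longleftrightarrow> g dvd p"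
    using ex_irreducible_annihilator[of x] by blast
  then have "g \<noteq> 0" by auto
  have dvd: "poly_ac p x = 0 \<longleftrightarrow> g dvd p" for p using g by blast
  obtain h where h: "h \<noteq> 0" "act h x = 0"
    using ex_q_linearized_multiple[OF \<open>g \<noteq> 0\<close>] unfolding act_def dvd by blast
  obtain f where f: "lead_coeff f = 1" "\<And>h. h \<in> {h. act h x = 0} \<longleftrightarrow> f dvd h"
    by (rule ideal_monic_generator[of "{h. act h x = 0}" h])
       (use h in \<open>auto simp: act_add_poly act_mult\<close>)
  then show thesis using that by (simp add: with_annihilator_def)
qed

text \<open>As \<open>g\<close> is a unit multiple of the minimal polynomial of \<open>x\<close>, it
  divides \<open>q_linearized h\<close> exactly when \<open>act h x = 0\<close>. The monic generator
  of the annihilator is thus the Order, which can be read off at any single root.\<close>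

lemma Fq_Order_eq_iff:
  fixes g :: "'a :: finite_field poly"
  assumes "Factorial_Ring.irreducible g" "poly_ac g x = 0" "lead_coeff f = 1"
  shows "Fq_Order g = f \<longleftrightarrow> x \<in> with_annihilator f"
proof -
  obtain f' where f': "lead_coeff f' = 1" "x \<in> with_annihilator f'" by (rule ex_annihilator)
  have g: "g \<noteq> 0" using assms(1) by auto
  have dvd: "g dvd q_linearized h \<longleftrightarrow> f' dvd h" for h
    using poly_ac_eq_0_iff_irreducible_dvd[OF assms(1,2), of "q_linearized h"] f'(2)
    by (simp add: with_annihilator_def act_def)
  have "is_Fq_Order g f'"
    unfolding is_Fq_Order_def dvd using f'(1) by (auto intro!: dvd_imp_degree_le)
  then have Fq_Order: "Fq_Order g = f'"
    using ex1_Fq_Order[OF g] is_Fq_Order_Fq_Order[OF g] by blast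
  have "x \<in> with_annihilator f \<longleftrightarrow> f = f'"
  proof
    assume "x \<in> with_annihilator f"
    note dvd = with_annihilatorD[OF this] with_annihilatorD[OF f'(2)]
    have "f dvd f'" using dvd(1)[of f'] dvd(2)[of f'] dvd_refl by blast
    moreover have "f' dvd f" using dvd(1)[of f] dvd(2)[of f] dvd_refl by blast
    ultimately show "f = f'" by (rule monic_dvd_antisym[OF assms(3) f'(1)])
  qed (use f' in simp)
  then show ?thesis using Fq_Order by auto
qed

subsection \<open>Counting roots\<close>

text \<open>A double root of \<open>p\<close> would be a double root of \<open>r\<close> and so a
  root of \<open>pderiv r\<close>. Hence the linear factors of \<open>p\<close> are
  distinct.\<close>

lemma card_roots_dvd_separable:
  fixes p r :: "'a :: alg_closed_field poly"
  assumes "p dvd r" "\<And>x. poly (pderiv r) x \<noteq> 0"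
  shows "card {x. poly p x = 0} = Polynomial.degree p"
proof -
  have r: "r \<noteq> 0" using assms(2)[of 0] by auto
  then have p: "p \<noteq> 0" using assms(1) by auto
  obtain A where A: "size A = Polynomial.degree p"
      "p = Polynomial.smult (lead_coeff p) (\<Prod>x\<in>#A. [:-x, 1:])"
    using alg_closed_imp_factorization[OF p] by blast
  have roots: "{x. poly p x = 0} = set_mset A"
    by (subst A(2)) (use p in \<open>auto simp: poly_prod_mset\<close>)
  have "count A x \<le> 1" for x
  proof (rule ccontr)
    assume "\<not> count A x \<le> 1"
    then have "replicate_mset 2 x \<subseteq># A"
      by (simp add: count_le_replicate_mset_subset_eq [symmetric])
    then obtain B where B: "A = replicate_mset 2 x + B"
      by (auto simp: subset_mset.le_iff_add)
    have "(\<Prod>x\<in>#A. [:-x, 1:]) = [:-x, 1:] * [:-x, 1:] * (\<Prod>x\<in>#B. [:-x, 1:])"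
      unfolding B by (simp only: image_mset_union prod_mset.union image_replicate_mset
          prod_mset_replicate_mset power2_eq_square)
    then have "[:-x, 1:] * [:-x, 1:] dvd p"
      by (subst A(2)) (simp only: dvd_smult dvd_triv_left)
    then obtain s where s: "r = [:-x, 1:] * [:-x, 1:] * s"
      using assms(1) by (meson dvdE dvd_trans)
    have "poly (pderiv r) x = 0"
      unfolding s by (simp only: pderiv_mult poly_add poly_mult) simp
    then show False using assms(2) by blast
  qed
  then have "A = mset_set (set_mset A)"
    by (intro multiset_eqI) (metis count_greater_zero_iff count_mset_set(1,3) finite_set_mset le_antisym not_gr_zero One_nat_def Suc_leI)
  then have "size A = card (set_mset A)"
    by (metis size_mset_set)
  then show ?thesis using A(1) roots by simp
qed

lemma map_poly_to_ac_dvd: "p dvd q \<Longrightarrow> map_poly to_ac p dvd map_poly to_ac q"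
  by (auto simp: map_poly_to_ac_mult elim!: dvdE)

lemma degree_map_poly_to_ac: "Polynomial.degree (map_poly to_ac p) = Polynomial.degree p"
  by (rule degree_map_poly) simp

text \<open>Translation by 1 permutes the field, so the sum of all elements equals itself plus
  \<open>q\<close> times 1.\<close>

lemma of_nat_card_eq_0: "of_nat CARD('a) = (0 :: 'a :: finite_field)"
proof -
  have "(\<Sum>x\<in>(UNIV :: 'a set). x) = (\<Sum>x\<in>UNIV. x + 1)"
    by (rule sum.reindex_bij_witness[of _ "\<lambda>x. x + 1" "\<lambda>x. x - 1"]) auto
  then show ?thesis by (simp add: sum.distrib)
qed

text \<open>Exponents \<open>q^i\<close> with \<open>i > 0\<close> vanish in the field, which leaves
  the derivative of the linear term. So \<open>poly f 0 \<noteq> 0\<close> makes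
  \<open>q_linearized f\<close> separable.\<close>

lemma pderiv_q_linearized:
  fixes h :: "'a :: finite_field poly"
  shows "pderiv (q_linearized h) = [:poly h 0:]"
proof -
  have deriv: "pderiv (Polynomial.monom c (CARD('a) ^ i)) = (if i = 0 then [:c:] else 0)" for c :: 'a and i
    by (cases i) (simp_all add: pderiv_monom of_nat_card_eq_0 monom_0)
  have "pderiv (q_linearized h) = (\<Sum>i\<le>Polynomial.degree h. if i = 0 then [:Polynomial.coeff h i:] else 0)"
    unfolding q_linearized_def
    by (subst sum_comp_morphism[of pderiv, symmetric]) (simp_all add: pderiv_add o_def deriv)
  also have "\<dots> = [:poly h 0:]"
    by (simp add: sum.delta' poly_0_coeff_0)
  finally show ?thesis .
qed

lemma pderiv_map_poly_to_ac: "pderiv (map_poly to_ac p) = map_poly to_ac (pderiv p)"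
  by (rule poly_eqI) (simp add: coeff_map_poly coeff_pderiv)

lemma degree_q_linearized:
  fixes h :: "'a :: finite_field poly"
  assumes "h \<noteq> 0"
  shows "Polynomial.degree (q_linearized h) = CARD('a) ^ Polynomial.degree h"
proof -
  let ?n = "Polynomial.degree h"
  have q: "CARD('a) > 1"
    by (rule one_less_card_field)
  have "Polynomial.degree (q_linearized h) \<le> CARD('a) ^ ?n"
    unfolding q_linearized_def
  proof (rule degree_sum_le)
    fix i assume "i \<in> {..?n}"
    then have "CARD('a) ^ i \<le> CARD('a) ^ ?n"
      using q by (intro power_increasing) auto
    then show "Polynomial.degree (Polynomial.monom (Polynomial.coeff h i) (CARD('a) ^ i)) \<le> CARD('a) ^ ?n"
      using degree_monom_le le_trans by blast
  qed simp
  moreover have "Polynomial.coeff (q_linearized h) (CARD('a) ^ ?n) = lead_coeff h"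
    unfolding q_linearized_def coeff_sum coeff_monom using q by simp
  ultimately show ?thesis
    using assms by (intro antisym le_degree) simp_all
qed

text \<open>With \<open>g = q_linearized f\<close> this counts the points killed by
  \<open>f\<close>; with \<open>g\<close> irreducible of Order \<open>f\<close> it counts the roots
  of \<open>g\<close>.\<close>

lemma card_roots_dvd_q_linearized:
  fixes g :: "'a :: finite_field poly"
  assumes "g dvd q_linearized f" "poly f 0 \<noteq> 0"
  shows "card {x. poly_ac g x = 0} = Polynomial.degree g"
proof -
  have "card {x. poly (map_poly to_ac g) x = 0} = Polynomial.degree (map_poly to_ac g)"
    by (rule card_roots_dvd_separable[OF map_poly_to_ac_dvd[OF assms(1)]])
       (use assms(2) in \<open>simp add: pderiv_map_poly_to_ac pderiv_q_linearized map_poly_pCons\<close>)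
  then show ?thesis by (simp add: poly_ac_def degree_map_poly_to_ac)
qed

lemma finite_roots: "p \<noteq> 0 \<Longrightarrow> finite {x. poly_ac p x = 0}"
  unfolding poly_ac_def by (rule poly_roots_finite) (simp add: map_poly_eq_0_iff)

lemma with_annihilator_subset: "with_annihilator f \<subseteq> {x. poly_ac (q_linearized f) x = 0}"
  using with_annihilatorD[of _ f f] by (auto simp: act_def)

lemma finite_with_annihilator:
  fixes f :: "'a :: finite_field poly"
  assumes "f \<noteq> 0"
  shows "finite (with_annihilator f)"
proof -
  have "Polynomial.degree (q_linearized f) \<noteq> 0"
    unfolding degree_q_linearized[OF assms] by simp
  then have "q_linearized f \<noteq> 0" by auto
  from finite_roots[OF this] show ?thesis
    by (rule finite_subset[OF with_annihilator_subset])
qed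

text \<open>The roots of \<open>q_linearized f\<close> are the points killed by \<open>f\<close>;
  the monic generators of their annihilators are divisors of \<open>f\<close> and sort them into
  disjoint classes.\<close>

lemma sum_card_with_annihilator:
  fixes f :: "'a :: finite_field poly"
  assumes "lead_coeff f = 1" "poly f 0 \<noteq> 0"
  shows "(\<Sum>d | lead_coeff d = 1 \<and> d dvd f. card (with_annihilator d)) = CARD('a) ^ Polynomial.degree f"
proof -
  let ?D = "{d. lead_coeff d = 1 \<and> d dvd f}"
  have f: "f \<noteq> 0" using assms(1) by auto
  have "(\<Sum>d\<in>?D. card (with_annihilator d)) = card (\<Union>d\<in>?D. with_annihilator d)"
  proof (rule card_UN_disjoint [symmetric])
    show "finite ?D" by (rule finite_monic_divisors[OF f])
    show "\<forall>d\<in>?D. finite (with_annihilator d)"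
      using f finite_with_annihilator by fastforce
    show "\<forall>d\<in>?D. \<forall>e\<in>?D. d \<noteq> e \<longrightarrow> with_annihilator d \<inter> with_annihilator e = {}"
    proof (intro ballI impI equals0I)
      fix d e x
      assume *: "d \<in> ?D" "e \<in> ?D" "d \<noteq> e" "x \<in> with_annihilator d \<inter> with_annihilator e"
      then have "x \<in> with_annihilator d" "x \<in> with_annihilator e" by blast+
      note dvd = this[THEN with_annihilatorD]
      have "d dvd e" using dvd(1)[of e] dvd(2)[of e] dvd_refl by blast
      moreover have "e dvd d" using dvd(1)[of d] dvd(2)[of d] dvd_refl by blast
      ultimately show False using monic_dvd_antisym[of d e] *(1-3) by blast
    qed
  qed
  also have "(\<Union>d\<in>?D. with_annihilator d) = {x. poly_ac (q_linearized f) x = 0}"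
  proof (intro equalityI subsetI)
    fix x assume "x \<in> (\<Union>d\<in>?D. with_annihilator d)"
    then obtain d where "d dvd f" "x \<in> with_annihilator d" by blast
    then show "x \<in> {x. poly_ac (q_linearized f) x = 0}"
      using with_annihilatorD[of x d f] by (simp add: act_def)
  next
    fix x assume x: "x \<in> {x. poly_ac (q_linearized f) x = 0}"
    obtain d where d: "lead_coeff d = 1" "x \<in> with_annihilator d" by (rule ex_annihilator)
    then have "d \<in> ?D" using x with_annihilatorD[of x d f] by (simp add: act_def)
    then show "x \<in> (\<Union>d\<in>?D. with_annihilator d)" using d(2) by blast
  qed
  also have "card \<dots> = CARD('a) ^ Polynomial.degree f"
    using card_roots_dvd_q_linearized[OF dvd_refl assms(2)] degree_q_linearized[OF f] by simp
  finally show ?thesis .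
qed

lemma card_with_annihilator:
  fixes f :: "'a :: finite_field poly"
  assumes "lead_coeff f = 1" "poly f 0 \<noteq> 0"
  shows "card (with_annihilator f) = poly_phi f"
  unfolding poly_phi_eq_card_unit_residues
  using sum_card_with_annihilator assms by (rule card_eq_card_unit_residues)

section \<open>The field generated by a root, and its Frobenius\<close>

text \<open>The range is the field \<open>F_q(x)\<close>, a copy of the residues modulo
  \<open>g\<close>: polynomials with the same value at \<open>x\<close> differ by a multiple of
  \<open>g\<close>.\<close>

lemma range_poly_ac:
  fixes g :: "'a :: finite_field poly"
  assumes "Factorial_Ring.irreducible g" "poly_ac g x = 0"
  shows "finite (range (\<lambda>p. poly_ac p x))"
    and "card (range (\<lambda>p. poly_ac p x)) = CARD('a) ^ Polynomial.degree g"
proof -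
  have g: "g \<noteq> 0" using assms(1) by auto
  have mod: "poly_ac (p mod g) x = poly_ac p x" for p
  proof -
    have "poly_ac p x = poly_ac (p div g * g + p mod g) x" by simp
    also have "\<dots> = poly_ac (p mod g) x"
      unfolding poly_ac_add poly_ac_mult assms(2) by simp
    finally show ?thesis ..
  qed
  have range: "range (\<lambda>p. poly_ac p x) = (\<lambda>p. poly_ac p x) ` {r. r mod g = r}"
  proof (intro equalityI subsetI)
    fix y assume "y \<in> range (\<lambda>p. poly_ac p x)"
    then obtain p where "y = poly_ac p x" by blast
    then have "y = poly_ac (p mod g) x" using mod by simp
    then show "y \<in> (\<lambda>p. poly_ac p x) ` {r. r mod g = r}" by (rule image_eqI) simp
  qed blast
  have "inj_on (\<lambda>p. poly_ac p x) {r. r mod g = r}"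
  proof (rule inj_onI)
    fix r s assume "r \<in> {r. r mod g = r}" "s \<in> {r. r mod g = r}" "poly_ac r x = poly_ac s x"
    then have *: "r mod g = r" "s mod g = s" "poly_ac (r - s) x = 0"
      by (simp_all add: poly_ac_diff)
    have "r mod g = s mod g"
      using *(3) poly_ac_eq_0_iff_irreducible_dvd[OF assms] by (simp only: mod_eq_dvd_iff)
    then show "r = s" by (simp only: *(1,2))
  qed
  then show "card (range (\<lambda>p. poly_ac p x)) = CARD('a) ^ Polynomial.degree g"
    unfolding range using card_residues(2)[OF g] by (simp add: card_image)
  show "finite (range (\<lambda>p. poly_ac p x))"
    unfolding range using card_residues(1)[OF g] by (rule finite_imageI)
qed

text \<open>Fermat's argument: multiplication by \<open>x \<noteq> 0\<close> permutes the nonzero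
  elements of \<open>F_q(x)\<close>, and comparing their products gives \<open>x\<close> to the
  power \<open>q^(deg g) - 1\<close> equal to 1.\<close>

lemma power_card_degree_eq_self:
  fixes g :: "'a :: finite_field poly"
  assumes "Factorial_Ring.irreducible g" "poly_ac g x = 0"
  shows "x ^ (CARD('a) ^ Polynomial.degree g) = x"
proof (cases "x = 0")
  case False
  let ?F = "range (\<lambda>p. poly_ac p x)"
  have F: "finite ?F" "card ?F = CARD('a) ^ Polynomial.degree g"
    using range_poly_ac[OF assms] .
  have "0 \<in> ?F" by (rule range_eqI[of _ _ 0]) simp
  have sub: "(*) x ` (?F - {0}) \<subseteq> ?F - {0}"
  proof
    fix y assume "y \<in> (*) x ` (?F - {0})"
    then obtain p where "y = x * poly_ac p x" "poly_ac p x \<noteq> 0" by blast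
    moreover from this have "y = poly_ac (pCons 0 p) x" by simp
    then have "y \<in> ?F" by blast
    ultimately show "y \<in> ?F - {0}" using False by simp
  qed
  have inj: "inj_on ((*) x) (?F - {0})"
    using False by (simp add: inj_on_def)
  have image: "(*) x ` (?F - {0}) = ?F - {0}"
    using endo_inj_surj[OF _ sub inj] F(1) by blast
  have "\<Prod>(?F - {0}) = (\<Prod>y\<in>?F - {0}. x * y)"
    using prod.reindex[OF inj, of "\<lambda>y. y"] unfolding image by (simp add: o_def)
  also have "\<dots> = x ^ card (?F - {0}) * \<Prod>(?F - {0})"
    by (simp add: prod.distrib)
  finally have "x ^ card (?F - {0}) = 1"
    using F(1) by simp
  moreover have "CARD('a) ^ Polynomial.degree g = Suc (card (?F - {0}))"
    using card_Suc_Diff1[OF F(1) \<open>0 \<in> ?F\<close>] F(2) by simp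
  ultimately show ?thesis by simp
qed (simp add: zero_power)

text \<open>The \<open>e\<close>-th power of the Frobenius then fixes all \<open>q^(deg g)\<close>
  elements of \<open>F_q(x)\<close>, which are therefore roots of a polynomial of degree at most
  \<open>q^e\<close>.\<close>

lemma degree_le_of_power_card_eq_self:
  fixes g :: "'a :: finite_field poly"
  assumes "Factorial_Ring.irreducible g" "poly_ac g x = 0"
    and "e > 0" "x ^ (CARD('a) ^ e) = x"
  shows "Polynomial.degree g \<le> e"
proof -
  have q: "CARD('a) > 1"
    by (rule one_less_card_field)
  let ?h = "Polynomial.monom 1 (CARD('a) ^ e) - [:0, 1:] :: 'a poly"
  \<comment> \<open>Here \<open>e > 0\<close> matters: for \<open>e = 0\<close> the polynomial
    \<open>?h\<close> would be zero.\<close>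
  have qe: "CARD('a) ^ e > 1" using q assms(3) by (rule one_less_power)
  have "Polynomial.coeff ?h (CARD('a) ^ e) = 1"
    using qe assms(3) by (auto simp: coeff_pCons split: nat.splits)
  then have h: "?h \<noteq> 0" by (metis coeff_0 zero_neq_one)
  have "range (\<lambda>p. poly_ac p x) \<subseteq> {y. poly_ac ?h y = 0}"
    by (auto simp: poly_ac_diff poly_ac_monom poly_ac_power_card_power assms(4))
  then have "CARD('a) ^ Polynomial.degree g \<le> card {y. poly_ac ?h y = 0}"
    unfolding range_poly_ac(2)[OF assms(1,2), symmetric]
    by (rule card_mono[OF finite_roots[OF h]])
  also have "\<dots> \<le> Polynomial.degree (map_poly to_ac ?h)"
    unfolding poly_ac_def by (rule card_poly_roots_bound) (use h in \<open>simp add: map_poly_eq_0_iff\<close>)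
  also have "\<dots> \<le> CARD('a) ^ e"
    unfolding degree_map_poly_to_ac using qe by (intro degree_diff_le) (auto simp: degree_monom_le)
  finally show ?thesis using q by simp
qed

text \<open>Both numbers are the least positive \<open>e\<close> with
  \<open>x ^ (q ^ e) = x\<close>.\<close>

lemma degree_eq_poly_ord:
  fixes g :: "'a :: finite_field poly"
  assumes "Factorial_Ring.irreducible g" "poly_ac g x = 0" "x \<in> with_annihilator f"
  shows "poly_ord f = Polynomial.degree g"
proof -
  have iff: "f dvd Polynomial.monom 1 e - 1 \<longleftrightarrow> x ^ (CARD('a) ^ e) = x" for e
    unfolding with_annihilatorD[OF assms(3), symmetric] by (simp add: act_diff act_monom)
  have "Polynomial.degree g > 0"
    using assms(1) by (auto simp: irreducible_def is_unit_iff_degree)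
  then show ?thesis
    unfolding poly_ord_def iff
    using power_card_degree_eq_self[OF assms(1,2)] degree_le_of_power_card_eq_self[OF assms(1,2)]
    by (intro Least_equality) auto
qed

section \<open>Grouping the points with annihilator \<open>(f)\<close> by their minimal
  polynomials\<close>

theorem proposition12:
  fixes f :: "'a :: finite_field poly" and n :: nat
  assumes "n \<ge> 1" and "Polynomial.lead_coeff f = 1" and "poly f 0 \<noteq> 0"
  shows "real (card {g :: 'a poly. Polynomial.lead_coeff g = 1 \<and> Factorial_Ring.irreducible g \<and>
                       Polynomial.degree g = n \<and> Fq_Order g = f}) =
         (if poly_ord f = n then real (poly_phi f) / real n else 0)"
proof -
  let ?G = "{g :: 'a poly. lead_coeff g = 1 \<and> Factorial_Ring.irreducible g \<and>
      Polynomial.degree g = n \<and> Fq_Order g = f}"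
  let ?R = "\<lambda>g. {x. poly_ac g x = 0}"
  have f: "f \<noteq> 0" using assms(2) by auto
  have roots: "?R g \<subseteq> with_annihilator f" if "g \<in> ?G" for g
    using that Fq_Order_eq_iff[of g _ f] assms(2) by auto
  show ?thesis
  proof (cases "poly_ord f = n")
    case False
    \<comment> \<open>A member of \<open>?G\<close> has a root in the closure, which forces
      \<open>poly_ord f\<close> to be its degree \<open>n\<close>.\<close>
    have "g \<notin> ?G" for g
    proof
      assume g: "g \<in> ?G"
      then obtain x where "poly_ac g x = 0" using ex_root_in_closure[of g] by blast
      then have "poly_ord f = Polynomial.degree g"
        using degree_eq_poly_ord[of g x f] roots[OF g] g by blast
      then show False using False g by simp
    qed
    then have "?G = {}" by blast
    then have "card ?G = 0" by (simp only: card.empty)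
    then show ?thesis using False by (simp only: if_False of_nat_0)
  next
    case True
    \<comment> \<open>Each point here is a root of its minimal polynomial, whose degree is
      \<open>poly_ord f = n\<close> and whose Order is \<open>f\<close>.\<close>
    have "with_annihilator f = (\<Union>g\<in>?G. ?R g)"
    proof (intro equalityI subsetI)
      fix x assume x: "x \<in> with_annihilator f"
      obtain g where g: "lead_coeff g = 1" "Factorial_Ring.irreducible g" "\<forall>p. poly_ac p x = 0 \<longleftrightarrow> g dvd p"
        using ex_irreducible_annihilator[of x] by blast
      have root: "poly_ac g x = 0" using g(3) dvd_refl by blast
      have "Polynomial.degree g = n"
        using degree_eq_poly_ord[OF g(2) root x] True by simp
      moreover have "Fq_Order g = f"
        using Fq_Order_eq_iff[OF g(2) root assms(2)] x by blast
      ultimately have "g \<in> ?G" using g(1,2) by blast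
      then show "x \<in> (\<Union>g\<in>?G. ?R g)" using root by blast
    qed (use roots in blast)
    also have "card \<dots> = (\<Sum>g\<in>?G. card (?R g))"
    proof (rule card_UN_disjoint)
      show "finite ?G"
        by (rule finite_subset[OF _ finite_polys_degree_le[of n]]) blast
      show "\<forall>g\<in>?G. finite (?R g)"
        using roots finite_with_annihilator[OF f] finite_subset by blast
      show "\<forall>g\<in>?G. \<forall>h\<in>?G. g \<noteq> h \<longrightarrow> ?R g \<inter> ?R h = {}"
      proof (intro ballI impI equals0I)
        fix g h x assume *: "g \<in> ?G" "h \<in> ?G" "g \<noteq> h" "x \<in> ?R g \<inter> ?R h"
        then have gh: "Factorial_Ring.irreducible g" "poly_ac g x = 0"
            "Factorial_Ring.irreducible h" "poly_ac h x = 0" by blast+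
        \<comment> \<open>Both are unit multiples of the minimal polynomial of the common root
          \<open>x\<close>.\<close>
        have "g dvd h" "h dvd g"
          using poly_ac_eq_0_iff_irreducible_dvd[OF gh(1,2), of h] gh(4)
            poly_ac_eq_0_iff_irreducible_dvd[OF gh(3,4), of g] gh(2) by blast+
        then show False using monic_dvd_antisym[of g h] *(1-3) by blast
      qed
    qed
    also have "\<dots> = (\<Sum>g\<in>?G. n)"
    proof (rule sum.cong[OF refl])
      fix g assume g: "g \<in> ?G"
      then have "g \<noteq> 0" by auto
      \<comment> \<open>As a divisor of a separable polynomial, \<open>g\<close> has as many roots
        as its degree \<open>n\<close>.\<close>
      then have "g dvd q_linearized f"
        using is_Fq_Order_Fq_Order[of g] g unfolding is_Fq_Order_def by blast
      then show "card (?R g) = n"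
        using card_roots_dvd_q_linearized[OF _ assms(3)] g by blast
    qed
    finally have "poly_phi f = card ?G * n"
      using card_with_annihilator[OF assms(2,3)] by simp
    then show ?thesis using True assms(1) by simp
  qed
qed

end
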